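(* Let $N,K_A,K_B,M$ be integers with $0\le N\le M$, $0\le K_A<K_B\le M$. Let $(k^*,\nu^*,P^*_0)$ be the parameters of the symmetric equilibrium of the Fisher game $\mathrm{Game}(N,K_A,K_B,M)$, and assume $\nu^*\neq0$. For $\gamma>0$, $\gamma\ne1$, let $(P^*_\gamma,\{p'^*_{\gamma,k}\})$ be the equilibrium parameters of the Statistical game $\mathrm{SGame}(N,K_A,K_B,M,\gamma)$. Then the equilibrium strategies of the Statistical game in the limit $\gamma\to0$ can be mapped to the symmetric equilibrium strategies of the Fisher game with the identification $$\lim_{\gamma\to0}p'^*_{\gamma,k^*}=\nu^*,\qquad \lim_{\gamma\to0}P^*_\gamma=P^*_0 .$$
   Context: Put $p_k(A)=\binom{K_A}{k}\binom{M-K_A}{N-k}/\binom MN$ and $p_k(B)=\binom{K_B}{k}\binom{M-K_B}{N-k}/\binom MN$ (binomial coefficients outside the usual range are $0$). Fisher game: Player 2 chooses a scenario $A$ or $B$ and a binary sequence of length $M$ with exactly $K_A$, resp. $K_B$, ones; Player 1 samples $N$ positions, observes the bits, and guesses the scenario; she wins iff the guess is correct. Its symmetric equilibrium: Player 2 chooses $A$ with probability $P^*_0$ and then a uniformly random allowed sequence; Player 1 samples uniformly and, observing $k$ ones, guesses $A$ if $k<k^*$, $B$ if $k>k^*$, and if $k=k^*$ guesses $A$ with probability $\nu^*$. The parameters are: $k^*$ is the smallest integer with $\sum_{k\le k^*}(p_k(A)+p_k(B))>1$; $$P^*_0=\frac{p_{k^*}(B)}{p_{k^*}(A)+p_{k^*}(B)},\qquad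 \nu^*=\frac{\sum_{k\ge k^*}p_k(B)-\sum_{k<k^*}p_k(A)}{p_{k^*}(A)+p_{k^*}(B)}\in[0,1).$$ Statistical game: as the Fisher game, but after sampling Player 1 places a portion $p'$ of her capital on $A$ and $1-p'$ on $B$; the portion on the scenario chosen by Player 2 is doubled, the rest is lost; Player 1 has isoelastic utility $u_\gamma(c)=\frac{c^{1-\gamma}-1}{1-\gamma}$ of her capital and the game is zero-sum in utilities. Its equilibrium: Player 2 chooses $A$ with probability $P^*_\gamma$ and then a uniformly random allowed sequence; Player 1 samples uniformly and, observing $k$ ones, places portion $p'^*_{\gamma,k}$ on $A$. The parameters are $p'^*_{\gamma,k}=p'_k(P^*_\gamma)$ with $$p'_k(P)=\frac{(P\,p_k(A))^{1/\gamma}}{(P\,p_k(A))^{1/\gamma}+((1-P)\,p_k(B))^{1/\gamma}},$$ and $P^*_\gamma$ is the unique minimizer over $P\in(0,1)$ of $U_\gamma(P)=P\sum_k p_k(A)u_\gamma(p'_k(P))+(1-P)\sum_kp_k(B)u_\gamma(1-p'_k(P))$ (terms with zero weight count as $0$). *)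

theory Defs
  imports "HOL-Analysis.Analysis"
begin

text \<open>
  Probability of seeing k ones among N positions sampled uniformly from a binary
  sequence of length M with exactly K ones.  The guard \<open>k \<le> N\<close> is needed because
  \<open>N - k\<close> truncates on natural numbers; with \<open>K \<le> M\<close> the subtraction \<open>M - K\<close> does not.
\<close>

definition ones_prob :: "nat \<Rightarrow> nat \<Rightarrow> nat \<Rightarrow> nat \<Rightarrow> real" where
  "ones_prob N K M k =
     (if k \<le> N then real (K choose k) * real ((M - K) choose (N - k)) / real (M choose N) else 0)"


section \<open>Fisher game\<close>

text \<open>
  Negative indices contribute nothing to the sums, so the smallest integer
  with the required property is a natural number.
\<close>

definition fisher_k :: "nat \<Rightarrow> nat \<Rightarrow> nat \<Rightarrow> nat \<Rightarrow> nat" where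
  "fisher_k N KA KB M = (LEAST n. (\<Sum>k\<le>n. ones_prob N KA M k + ones_prob N KB M k) > 1)"

definition fisher_P :: "nat \<Rightarrow> nat \<Rightarrow> nat \<Rightarrow> nat \<Rightarrow> real" where
  "fisher_P N KA KB M =
     (let ks = fisher_k N KA KB M
      in ones_prob N KB M ks / (ones_prob N KA M ks + ones_prob N KB M ks))"

definition fisher_nu :: "nat \<Rightarrow> nat \<Rightarrow> nat \<Rightarrow> nat \<Rightarrow> real" where
  "fisher_nu N KA KB M =
     (let ks = fisher_k N KA KB M
      in ((\<Sum>k=ks..N. ones_prob N KB M k) - (\<Sum>k<ks. ones_prob N KA M k))
           / (ones_prob N KA M ks + ones_prob N KB M ks))"

text \<open>Equilibrium probability that Player 1 guesses scenario A after observing k ones.\<close>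

definition fisher_guess :: "nat \<Rightarrow> nat \<Rightarrow> nat \<Rightarrow> nat \<Rightarrow> nat \<Rightarrow> real" where
  "fisher_guess N KA KB M k =
     (if k < fisher_k N KA KB M then 1
      else if k = fisher_k N KA KB M then fisher_nu N KA KB M
      else 0)"


section \<open>Statistical game\<close>

definition iso_utility :: "real \<Rightarrow> real \<Rightarrow> real" where
  "iso_utility \<gamma> c = (c powr (1 - \<gamma>) - 1) / (1 - \<gamma>)"

text \<open>
  Portion placed on A after observing k ones, when Player 2 chooses A with probability P.
  If k is impossible under both scenarios this is \<open>0 / 0 = 0\<close>, an irrelevant value.
\<close>

definition stat_portion :: "nat \<Rightarrow> nat \<Rightarrow> nat \<Rightarrow> nat \<Rightarrow> real \<Rightarrow> real \<Rightarrow> nat \<Rightarrow> real" where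
  "stat_portion N KA KB M \<gamma> P k =
     (P * ones_prob N KA M k) powr (1 / \<gamma>)
       / ((P * ones_prob N KA M k) powr (1 / \<gamma>) + ((1 - P) * ones_prob N KB M k) powr (1 / \<gamma>))"

text \<open>
  For \<open>\<gamma> > 1\<close> the utility of capital 0 is minus infinity, whereas here \<open>0 powr (1 - \<gamma>) = 0\<close>.
  For \<open>0 < P < 1\<close> a portion is 0 only where its weight vanishes, and such terms count as 0.
\<close>

definition stat_utility :: "nat \<Rightarrow> nat \<Rightarrow> nat \<Rightarrow> nat \<Rightarrow> real \<Rightarrow> real \<Rightarrow> real" where
  "stat_utility N KA KB M \<gamma> P =
     P * (\<Sum>k\<le>N. ones_prob N KA M k * iso_utility \<gamma> (stat_portion N KA KB M \<gamma> P k))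
     + (1 - P) * (\<Sum>k\<le>N. ones_prob N KB M k * iso_utility \<gamma> (1 - stat_portion N KA KB M \<gamma> P k))"

definition stat_P :: "nat \<Rightarrow> nat \<Rightarrow> nat \<Rightarrow> nat \<Rightarrow> real \<Rightarrow> real" where
  "stat_P N KA KB M \<gamma> =
     (THE P. is_arg_min (stat_utility N KA KB M \<gamma>) (\<lambda>P. P \<in> {0<..<1}) P)"

definition stat_bet :: "nat \<Rightarrow> nat \<Rightarrow> nat \<Rightarrow> nat \<Rightarrow> real \<Rightarrow> nat \<Rightarrow> real" where
  "stat_bet N KA KB M \<gamma> k = stat_portion N KA KB M \<gamma> (stat_P N KA KB M \<gamma>) k"

end

theory Submission
  imports Defs
begin

text \<open>
  Write \<open>a\<^sub>k\<close>, \<open>b\<^sub>k\<close> for the probabilities of \<open>k\<close> ones under A and B, \<open>k0\<close> for the Fisher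
  threshold and \<open>p\<^sub>k(P)\<close> for the optimal portion when A has prior probability \<open>P\<close>.  For fixed
  bets \<open>p\<close> the expected utility is affine in \<open>P\<close>, and for \<open>\<gamma> < 1\<close> its slope is, up to the
  factor \<open>1 / (1 - \<gamma>)\<close>, the sum over \<open>k\<close> of
  \<open>a\<^sub>k * p\<^sub>k powr (1 - \<gamma>) - b\<^sub>k * (1 - p\<^sub>k) powr (1 - \<gamma>)\<close>.
  If the bets optimal for a prior \<open>P\<close> make this slope vanish, they guarantee the same utility
  against every prior, while against another prior \<open>Q\<close> the bets optimal for \<open>Q\<close> do strictly
  better.  Hence \<open>P\<close> is the unique minimizer of the optimal utility
  (\<open>is_arg_min_unique_at_slope_root\<close>).  The whole question is therefore about the root in \<open>P\<close>
  of the slope at the optimal bets.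

  As \<open>\<gamma>\<close> tends to 0 the optimal bets turn into bets on the more likely scenario: \<open>p\<^sub>k(P)\<close>
  tends to 1 where \<open>P a\<^sub>k > (1 - P) b\<^sub>k\<close> and to 0 where \<open>P a\<^sub>k < (1 - P) b\<^sub>k\<close>.  The likelihood
  ratio \<open>a\<^sub>k / b\<^sub>k\<close> strictly decreases in \<open>k\<close>, and the prior \<open>P0\<close> of the Fisher game is the one
  that makes \<open>k0\<close> a tie.  So for \<open>P\<close> slightly below \<open>P0\<close> the bets tend to 1 exactly for
  \<open>k < k0\<close>, and the slope tends to the sum of \<open>a\<^sub>k + b\<^sub>k\<close> over \<open>k < k0\<close> minus 1; slightly above
  \<open>P0\<close> the index \<open>k0\<close> joins the sum.  By the choice of \<open>k0\<close>, and because \<open>\<nu> \<noteq> 0\<close>, the first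
  limit is negative and the second positive.  Hence for small \<open>\<gamma>\<close> the slope has a root
  arbitrarily close to \<open>P0\<close>, which gives the limit of the priors.  With it the bets at
  \<open>k \<noteq> k0\<close> converge to 1 or 0, and the equation "slope = 0" then leaves \<open>\<nu>\<close> as the only
  possible limit of the bet at \<open>k0\<close>.
\<close>

section \<open>Tangents to the isoelastic utility\<close>

text \<open>
  Strict concavity of the power function in tangent form.  With \<open>m = 1 + s (t - 1)\<close>, the
  weighted mean of \<open>t\<close> and 1, the inequality \<open>ln x \<le> x - 1\<close> is applied to \<open>t / m\<close> and \<open>1 / m\<close>;
  the two right-hand sides cancel after weighting by \<open>s\<close> and \<open>1 - s\<close>.  The first inequality is
  strict because \<open>t \<noteq> m\<close> for \<open>t \<noteq> 1\<close>.
\<close>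
lemma powr_tangent_at_1:
  fixes t s :: real
  assumes "0 \<le> t" "0 < s" "s < 1"
  shows powr_le_tangent_at_1: "t powr s \<le> 1 + s * (t - 1)"
    and powr_less_tangent_at_1: "t \<noteq> 1 \<Longrightarrow> t powr s < 1 + s * (t - 1)"
proof -
  show less: "t powr s < 1 + s * (t - 1)" if "t \<noteq> 1"
  proof (cases "t = 0")
    case False
    define m where "m = 1 + s * (t - 1)"
    have "m = (1 - s) + s * t" by (simp add: m_def algebra_simps)
    then have m: "m > 0" using assms False by (simp add: add_pos_pos)
    have tm: "t / m \<noteq> 1"
    proof
      assume "t / m = 1"
      then have "(1 - s) * (t - 1) = 0" using m by (simp add: m_def field_simps)
      then show False using assms that by simp
    qed
    have "ln (t / m) < t / m - 1"
      using ln_le_minus_one[of "t / m"] ln_eq_minus_one[of "t / m"] tm m assms False by force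
    then have "s * ln (t / m) < s * (t / m - 1)" using assms by simp
    moreover have "(1 - s) * ln (1 / m) \<le> (1 - s) * (1 / m - 1)"
      using ln_le_minus_one[of "1 / m"] m assms by (intro mult_left_mono) auto
    moreover have "s * (t / m - 1) + (1 - s) * (1 / m - 1) = 0"
    proof -
      have "s * (t / m - 1) + (1 - s) * (1 / m - 1) = (1 + s * (t - 1)) / m - 1"
        by (simp add: field_simps add_divide_distrib diff_divide_distrib)
      then show ?thesis using m by (simp add: m_def)
    qed
    ultimately have "s * ln (t / m) + (1 - s) * ln (1 / m) < 0" by linarith
    then have "s * ln t < ln m"
      using m assms False by (simp add: ln_div algebra_simps)
    then have "exp (s * ln t) < m" using m by (metis exp_less_cancel_iff exp_ln)
    then show ?thesis using False by (simp add: powr_def m_def)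
  qed (use assms in simp)
  show "t powr s \<le> 1 + s * (t - 1)"
    using less by (cases "t = 1") auto
qed

text \<open>
  The exponent \<open>1 - \<gamma>\<close> may be replaced by 1 in the limit even when \<open>p\<close> itself is not known to
  converge; this is the situation of the bet at the threshold.
\<close>
lemma powr_minus_self_tendsto_0:
  fixes p :: "real \<Rightarrow> real"
  assumes "\<And>\<gamma>. 0 \<le> p \<gamma>" "\<And>\<gamma>. p \<gamma> \<le> 1"
  shows "((\<lambda>\<gamma>. p \<gamma> powr (1 - \<gamma>) - p \<gamma>) \<longlongrightarrow> 0) (at_right 0)"
proof (rule Lim_null_comparison)
  have "\<forall>\<^sub>F \<gamma> in at_right 0. \<gamma> \<in> {0<..<1::real}" by (rule eventually_at_right_real) simp
  then show "\<forall>\<^sub>F \<gamma> in at_right 0. norm (p \<gamma> powr (1 - \<gamma>) - p \<gamma>) \<le> \<gamma>"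
  proof eventually_elim
    case (elim \<gamma>)
    have "p \<gamma> powr 1 \<le> p \<gamma> powr (1 - \<gamma>)"
      using elim assms[of \<gamma>] by (intro powr_mono') auto
    moreover have "p \<gamma> powr (1 - \<gamma>) \<le> 1 + (1 - \<gamma>) * (p \<gamma> - 1)"
      using elim assms[of \<gamma>] by (intro powr_le_tangent_at_1) auto
    moreover have "0 \<le> \<gamma> * p \<gamma>" using elim assms[of \<gamma>] by simp
    ultimately show ?case using assms[of \<gamma>] by (simp add: algebra_simps)
  qed
qed (rule tendsto_ident_at)

lemma iso_utility_tangent:
  assumes "0 \<le> c" "0 < d" "0 < \<gamma>" "\<gamma> < 1"
  shows iso_utility_le_tangent: "iso_utility \<gamma> c \<le> iso_utility \<gamma> d + d powr (-\<gamma>) * (c - d)"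
    and iso_utility_less_tangent:
      "c \<noteq> d \<Longrightarrow> iso_utility \<gamma> c < iso_utility \<gamma> d + d powr (-\<gamma>) * (c - d)"
proof -
  define s where "s = 1 - \<gamma>"
  have s: "0 < s" "s < 1" using assms by (auto simp: s_def)
  have "c powr s = d powr s * (c / d) powr s"
    using assms by (simp add: powr_divide)
  moreover have "d powr s * (1 + s * (c / d - 1)) = d powr s + s * (d powr (-\<gamma>) * (c - d))"
  proof -
    have "d powr s = d powr (-\<gamma>) * d"
      using assms by (simp add: s_def powr_diff powr_minus field_simps)
    then show ?thesis using assms by (simp add: field_simps)
  qed
  moreover have "(c / d) powr s \<le> 1 + s * (c / d - 1)"
    "c \<noteq> d \<Longrightarrow> (c / d) powr s < 1 + s * (c / d - 1)"
    using powr_tangent_at_1[of "c / d" s] s assms by auto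
  moreover have "0 < d powr s" using assms by simp
  ultimately have "c powr s \<le> d powr s + s * (d powr (-\<gamma>) * (c - d))"
    "c \<noteq> d \<Longrightarrow> c powr s < d powr s + s * (d powr (-\<gamma>) * (c - d))"
    by (metis mult_left_mono less_imp_le, metis mult_strict_left_mono)
  then show "iso_utility \<gamma> c \<le> iso_utility \<gamma> d + d powr (-\<gamma>) * (c - d)"
    "c \<noteq> d \<Longrightarrow> iso_utility \<gamma> c < iso_utility \<gamma> d + d powr (-\<gamma>) * (c - d)"
    using s by (auto simp: iso_utility_def divide_simps ac_simps simp flip: s_def)
qed

section \<open>Optimal portions\<close>
definition portion :: "real \<Rightarrow> real \<Rightarrow> real \<Rightarrow> real" where
  "portion \<gamma> x y = x powr (1 / \<gamma>) / (x powr (1 / \<gamma>) + y powr (1 / \<gamma>))"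

lemma portion_bounds: "0 \<le> portion \<gamma> x y" "portion \<gamma> x y \<le> 1"
  unfolding portion_def
  by (simp, smt (verit) divide_le_eq_1 powr_ge_zero)

lemma portion_swap:
  assumes "x \<noteq> 0 \<or> y \<noteq> 0"
  shows "1 - portion \<gamma> x y = portion \<gamma> y x"
proof -
  define S where "S = x powr (1 / \<gamma>) + y powr (1 / \<gamma>)"
  have "S \<noteq> 0"
    using assms add_nonneg_eq_0_iff[OF powr_ge_zero powr_ge_zero, of x "1 / \<gamma>" y "1 / \<gamma>"]
    by (simp add: S_def)
  moreover have "portion \<gamma> x y = (S - y powr (1 / \<gamma>)) / S" "portion \<gamma> y x = y powr (1 / \<gamma>) / S"
    by (simp_all add: portion_def S_def add.commute)
  ultimately show ?thesis by (simp add: diff_divide_distrib)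
qed

lemma portion_0 [simp]: "portion \<gamma> 0 y = 0"
  by (simp add: portion_def)

lemma portion_x_0 [simp]: "x \<noteq> 0 \<Longrightarrow> portion \<gamma> x 0 = 1"
  by (simp add: portion_def)

text \<open>
  The first-order condition for optimality: the right-hand side is symmetric in \<open>x\<close> and \<open>y\<close>,
  so the two scenarios have the same weighted marginal utility.
\<close>
lemma marginal_utility_portion:
  assumes "0 < x" "0 < \<gamma>"
  shows "x * portion \<gamma> x y powr (-\<gamma>) = (x powr (1 / \<gamma>) + y powr (1 / \<gamma>)) powr \<gamma>"
  using assms by (simp add: portion_def powr_divide powr_minus powr_powr add_pos_nonneg)

text \<open>
  The tangents to the utility at \<open>p\<close> and at \<open>1 - p\<close>, weighted by \<open>x\<close> and \<open>y\<close>, have equal slopes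
  in absolute value, so their linear parts cancel.  A zero weight pushes \<open>p\<close> to the boundary, where
  only the sign of the remaining linear part matters.
\<close>
lemma portion_best_response:
  assumes "0 \<le> x" "0 \<le> y" "0 \<le> c" "c \<le> 1" "0 < \<gamma>" "\<gamma> < 1"
  defines "p \<equiv> portion \<gamma> x y"
  shows portion_best_response_le:
      "x * iso_utility \<gamma> c + y * iso_utility \<gamma> (1 - c) \<le> x * iso_utility \<gamma> p + y * iso_utility \<gamma> (1 - p)"
    and portion_best_response_less:
      "0 < x \<Longrightarrow> 0 < y \<Longrightarrow> c \<noteq> p \<Longrightarrow>
       x * iso_utility \<gamma> c + y * iso_utility \<gamma> (1 - c) < x * iso_utility \<gamma> p + y * iso_utility \<gamma> (1 - p)"
proof -
  define m where "m = (x powr (1 / \<gamma>) + y powr (1 / \<gamma>)) powr \<gamma>"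
  have x: "x * iso_utility \<gamma> c \<le> x * iso_utility \<gamma> p + m * (c - p)"
    "c \<noteq> p \<Longrightarrow> x * iso_utility \<gamma> c < x * iso_utility \<gamma> p + m * (c - p)" if "0 < x"
  proof -
    have "0 < p" using that by (simp add: p_def portion_def add_pos_nonneg)
    then show "x * iso_utility \<gamma> c \<le> x * iso_utility \<gamma> p + m * (c - p)"
      "c \<noteq> p \<Longrightarrow> x * iso_utility \<gamma> c < x * iso_utility \<gamma> p + m * (c - p)"
      using iso_utility_tangent[of c p \<gamma>] marginal_utility_portion[of x \<gamma> y] that assms
        mult_left_mono[of "iso_utility \<gamma> c" "iso_utility \<gamma> p + p powr (-\<gamma>) * (c - p)" x]
        mult_strict_left_mono[of "iso_utility \<gamma> c" "iso_utility \<gamma> p + p powr (-\<gamma>) * (c - p)" x]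
      by (auto simp: m_def distrib_left simp flip: mult.assoc)
  qed
  have y: "y * iso_utility \<gamma> (1 - c) \<le> y * iso_utility \<gamma> (1 - p) - m * (c - p)" if "0 < y"
  proof -
    have p': "1 - p = portion \<gamma> y x" using that by (simp add: p_def portion_swap)
    then have "0 < 1 - p" using that by (simp add: portion_def add_pos_nonneg)
    then have "y * iso_utility \<gamma> (1 - c)
        \<le> y * (iso_utility \<gamma> (1 - p) + (1 - p) powr (-\<gamma>) * ((1 - c) - (1 - p)))"
      using assms that by (intro mult_left_mono iso_utility_le_tangent) auto
    also have "\<dots> = y * iso_utility \<gamma> (1 - p) + (y * (1 - p) powr (-\<gamma>)) * (p - c)"
      by (simp add: algebra_simps)
    also have "y * (1 - p) powr (-\<gamma>) = m"
      using marginal_utility_portion[of y \<gamma> x] that assms p' by (simp add: m_def add.commute)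
    finally show ?thesis by (simp add: algebra_simps)
  qed
  show "x * iso_utility \<gamma> c + y * iso_utility \<gamma> (1 - c) < x * iso_utility \<gamma> p + y * iso_utility \<gamma> (1 - p)"
    if "0 < x" "0 < y" "c \<noteq> p"
    using x(2) y that by linarith
  consider "x = 0" "y = 0" | "x = 0" "0 < y" | "0 < x" "y = 0" | "0 < x" "0 < y"
    using assms by fastforce
  then show "x * iso_utility \<gamma> c + y * iso_utility \<gamma> (1 - c)
      \<le> x * iso_utility \<gamma> p + y * iso_utility \<gamma> (1 - p)"
  proof cases
    case 2
    then have "m * (c - p) \<ge> 0" using assms by (simp add: m_def)
    then show ?thesis using y[OF 2(2)] by (simp only: 2(1) mult_zero_left add_0)
  next
    case 3
    then have "p = 1" by (simp add: p_def)
    then have "m * (c - p) \<le> 0" using assms by (simp add: m_def mult_nonneg_nonpos)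
    then show ?thesis using x(1)[OF 3(1)] by (simp only: 3(2) mult_zero_left add_0_right)
  next
    case 4
    then show ?thesis using x(1) y by linarith
  qed simp
qed

lemma powr_inverse_tendsto_0:
  fixes r :: real
  assumes "0 < r" "r < 1"
  shows "((\<lambda>\<gamma>. r powr (1 / \<gamma>)) \<longlongrightarrow> 0) (at_right 0)"
proof -
  have "filterlim (\<lambda>\<gamma>::real. 1 / \<gamma>) at_top (at_right 0)"
    by (simp add: filterlim_inverse_at_top_right flip: inverse_eq_divide)
  then have "filterlim (\<lambda>\<gamma>. ln r * (1 / \<gamma>)) at_bot (at_right 0)"
    using assms by (simp only: filterlim_tendsto_neg_mult_at_bot[OF tendsto_const] ln_less_zero)
  then have "((\<lambda>\<gamma>. exp (ln r * (1 / \<gamma>))) \<longlongrightarrow> 0) (at_right 0)"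
    using exp_at_bot by (rule filterlim_compose[rotated])
  then show ?thesis using assms by (simp add: powr_def)
qed

text \<open>
  The portion on the losing side is at most \<open>(y / x) powr (1 / \<gamma>)\<close>, and the ratio eventually stays
  below a constant less than 1.
\<close>
lemma portion_tendsto_1:
  assumes "(x \<longlongrightarrow> X) (at_right 0)" "(y \<longlongrightarrow> Y) (at_right 0)"
    and "\<forall>\<^sub>F \<gamma> in at_right 0. 0 \<le> y \<gamma>" and "Y < X"
  shows "((\<lambda>\<gamma>. portion \<gamma> (x \<gamma>) (y \<gamma>)) \<longlongrightarrow> 1) (at_right 0)"
proof -
  have Y: "0 \<le> Y" using tendsto_lowerbound[OF assms(2,3)] by simp
  with assms have X: "0 < X" by simp
  obtain r where r: "Y / X < r" "r < 1"
    using dense[of "Y / X" 1] assms X by (auto simp: divide_less_eq)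
  have r0: "0 < r" using r X Y by (meson divide_nonneg_pos le_less_trans)
  have "\<forall>\<^sub>F \<gamma> in at_right 0. 0 < x \<gamma>" using order_tendstoD(1)[OF assms(1) X] .
  moreover have "\<forall>\<^sub>F \<gamma> in at_right 0. y \<gamma> / x \<gamma> < r"
    using r(1) assms X by (intro order_tendstoD(2)[OF tendsto_divide]) auto
  ultimately have "\<forall>\<^sub>F \<gamma> in at_right 0. norm (1 - portion \<gamma> (x \<gamma>) (y \<gamma>)) \<le> r powr (1 / \<gamma>)"
    using assms(3) eventually_at_right_less[of "0::real"]
  proof eventually_elim
    case (elim \<gamma>)
    have "1 - portion \<gamma> (x \<gamma>) (y \<gamma>) = portion \<gamma> (y \<gamma>) (x \<gamma>)" using elim by (simp add: portion_swap)
    also have "\<dots> \<le> y \<gamma> powr (1 / \<gamma>) / x \<gamma> powr (1 / \<gamma>)"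
      using elim unfolding portion_def by (intro divide_left_mono mult_pos_pos add_nonneg_pos) auto
    also have "\<dots> = (y \<gamma> / x \<gamma>) powr (1 / \<gamma>)" using elim by (simp add: powr_divide)
    also have "\<dots> \<le> r powr (1 / \<gamma>)" using elim by (intro powr_mono2) auto
    finally show ?case using portion_bounds[of \<gamma> "x \<gamma>" "y \<gamma>"] by simp
  qed
  then have "((\<lambda>\<gamma>. 1 - portion \<gamma> (x \<gamma>) (y \<gamma>)) \<longlongrightarrow> 0) (at_right 0)"
    by (rule Lim_null_comparison) (rule powr_inverse_tendsto_0[OF r0 r(2)])
  from tendsto_diff[OF tendsto_const[of 1] this] show ?thesis by simp
qed

lemma portion_tendsto_0:
  assumes "(x \<longlongrightarrow> X) (at_right 0)" "(y \<longlongrightarrow> Y) (at_right 0)"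
    and "\<forall>\<^sub>F \<gamma> in at_right 0. 0 \<le> x \<gamma>" and "X < Y"
  shows "((\<lambda>\<gamma>. portion \<gamma> (x \<gamma>) (y \<gamma>)) \<longlongrightarrow> 0) (at_right 0)"
proof -
  have "0 \<le> X" using tendsto_lowerbound[OF assms(1,3)] by simp
  then have "\<forall>\<^sub>F \<gamma> in at_right 0. 0 < y \<gamma>" using assms by (intro order_tendstoD(1)[OF assms(2)]) auto
  then have "\<forall>\<^sub>F \<gamma> in at_right 0. 1 - portion \<gamma> (y \<gamma>) (x \<gamma>) = portion \<gamma> (x \<gamma>) (y \<gamma>)"
    by eventually_elim (simp add: portion_swap)
  moreover have "((\<lambda>\<gamma>. 1 - portion \<gamma> (y \<gamma>) (x \<gamma>)) \<longlongrightarrow> 1 - 1) (at_right 0)"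
    by (intro tendsto_diff tendsto_const portion_tendsto_1[OF assms(2,1,3,4)])
  ultimately show ?thesis using tendsto_cong by force
qed

text \<open>The odds \<open>(1 - P) b / (P a)\<close> against A decrease strictly as \<open>P\<close> grows.\<close>
lemma portion_posterior_strict_mono:
  assumes "0 < a" "0 < b" "0 < \<gamma>" "0 < P" "P < Q" "Q < 1"
  shows "portion \<gamma> (P * a) ((1 - P) * b) < portion \<gamma> (Q * a) ((1 - Q) * b)"
proof -
  have eq: "portion \<gamma> x y = 1 / (1 + (y / x) powr (1 / \<gamma>))" if "0 < x" "0 < y" for x y
    using that by (simp add: portion_def powr_divide field_simps)
  have "(1 - Q) * b / (Q * a) < (1 - P) * b / (P * a)"
    using assms by (intro frac_less mult_strict_right_mono mult_right_mono) auto
  then have "((1 - Q) * b / (Q * a)) powr (1 / \<gamma>) < ((1 - P) * b / (P * a)) powr (1 / \<gamma>)"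
    using assms by (intro powr_less_mono2) auto
  then show ?thesis
    using assms by (simp add: eq frac_less2 add_pos_nonneg)
qed

lemma continuous_on_portion_posterior:
  assumes "0 \<le> a" "0 \<le> b" "0 < \<gamma>"
  shows "continuous_on {0<..<1} (\<lambda>P. portion \<gamma> (P * a) ((1 - P) * b))"
proof (cases "a = 0")
  case False
  then show ?thesis using assms unfolding portion_def
    by (intro continuous_intros continuous_on_powr') (auto simp: add_nonneg_eq_0_iff)
qed simp

section \<open>Betting on two distributions separated by a threshold\<close>

text \<open>
  The two properties of the hypergeometric distributions that determine the limit: \<open>a k / b k\<close> is
  above its value at \<open>k0\<close> for \<open>k < k0\<close> and below it for \<open>k > k0\<close>, written without division because
  either probability may vanish, and the total mass of both distributions passes 1 strictly at
  \<open>k0\<close>.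
\<close>
locale betting_game =
  fixes N :: nat and a b :: "nat \<Rightarrow> real" and k0 :: nat
  assumes a_nonneg: "\<And>k. 0 \<le> a k" and b_nonneg: "\<And>k. 0 \<le> b k"
    and sum_a: "(\<Sum>k\<le>N. a k) = 1" and sum_b: "(\<Sum>k\<le>N. b k) = 1"
    and k0_le: "k0 \<le> N" and a_k0: "0 < a k0" and b_k0: "0 < b k0"
    and below_k0: "\<And>k. k < k0 \<Longrightarrow> 0 < a k + b k \<Longrightarrow> a k0 * b k < a k * b k0"
    and above_k0: "\<And>k. k0 < k \<Longrightarrow> 0 < a k + b k \<Longrightarrow> a k * b k0 < a k0 * b k"
    and sum_below_k0: "(\<Sum>k<k0. a k + b k) < 1"
    and sum_upto_k0: "1 < (\<Sum>k\<le>k0. a k + b k)"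
begin

definition P0 :: real where "P0 = b k0 / (a k0 + b k0)"

definition \<nu> :: real where
  "\<nu> = ((\<Sum>k=k0..N. b k) - (\<Sum>k<k0. a k)) / (a k0 + b k0)"

definition bet :: "real \<Rightarrow> real \<Rightarrow> nat \<Rightarrow> real" where
  "bet \<gamma> P k = portion \<gamma> (P * a k) ((1 - P) * b k)"

text \<open>
  Prior and bets are separate arguments: keeping the bets fixed while the prior varies is what makes
  the payoff affine.
\<close>
definition payoff :: "real \<Rightarrow> real \<Rightarrow> (nat \<Rightarrow> real) \<Rightarrow> real" where
  "payoff \<gamma> P p = P * (\<Sum>k\<le>N. a k * iso_utility \<gamma> (p k))
     + (1 - P) * (\<Sum>k\<le>N. b k * iso_utility \<gamma> (1 - p k))"

text \<open>
  \<open>1 - \<gamma>\<close> times the slope of \<open>\<lambda>Q. payoff \<gamma> Q (bet \<gamma> P)\<close>; the constants in the utility cancel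
  because both distributions have total mass 1.
\<close>
definition slope :: "real \<Rightarrow> real \<Rightarrow> real" where
  "slope \<gamma> P = (\<Sum>k\<le>N. a k * bet \<gamma> P k powr (1 - \<gamma>) - b k * (1 - bet \<gamma> P k) powr (1 - \<gamma>))"

lemma P0_bounds: "0 < P0" "P0 < 1"
  using a_k0 b_k0 by (auto simp: P0_def field_simps)

lemma P0_tie: "P0 * a k0 = (1 - P0) * b k0"
  using a_k0 b_k0 by (simp add: P0_def field_simps)

lemma P0_below:
  assumes "k < k0" "0 < a k + b k"
  shows "(1 - P0) * b k < P0 * a k"
proof -
  have "1 - P0 = a k0 / (a k0 + b k0)" using a_k0 b_k0 by (simp add: P0_def field_simps)
  then show ?thesis
    using below_k0[OF assms] a_k0 b_k0 by (simp add: P0_def divide_strict_right_mono ac_simps)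
qed

lemma P0_above:
  assumes "k0 < k" "0 < a k + b k"
  shows "P0 * a k < (1 - P0) * b k"
proof -
  have "1 - P0 = a k0 / (a k0 + b k0)" using a_k0 b_k0 by (simp add: P0_def field_simps)
  then show ?thesis
    using above_k0[OF assms] a_k0 b_k0 by (simp add: P0_def divide_strict_right_mono ac_simps)
qed

lemma bet_bounds: "0 \<le> bet \<gamma> P k" "bet \<gamma> P k \<le> 1"
  by (simp_all add: bet_def portion_bounds)

lemma payoff_eq:
  "payoff \<gamma> P p = (\<Sum>k\<le>N. (P * a k) * iso_utility \<gamma> (p k) + ((1 - P) * b k) * iso_utility \<gamma> (1 - p k))"
  by (simp add: payoff_def sum.distrib sum_distrib_left mult.assoc)

text \<open>
  Both scenarios are possible at \<open>k0\<close>, so the optimal portion there is unique and any deviation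
  from it costs utility.
\<close>
lemma payoff_less_best_response:
  assumes "0 < Q" "Q < 1" "0 < \<gamma>" "\<gamma> < 1"
    and "\<And>k. 0 \<le> p k" "\<And>k. p k \<le> 1" and "p k0 \<noteq> bet \<gamma> Q k0"
  shows "payoff \<gamma> Q p < payoff \<gamma> Q (bet \<gamma> Q)"
  unfolding payoff_eq
proof (rule sum_strict_mono_ex1)
  show "\<forall>k\<in>{..N}. (Q * a k) * iso_utility \<gamma> (p k) + ((1 - Q) * b k) * iso_utility \<gamma> (1 - p k)
      \<le> (Q * a k) * iso_utility \<gamma> (bet \<gamma> Q k) + ((1 - Q) * b k) * iso_utility \<gamma> (1 - bet \<gamma> Q k)"
    unfolding bet_def using assms a_nonneg b_nonneg by (intro ballI portion_best_response_le) auto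
  show "\<exists>k\<in>{..N}. (Q * a k) * iso_utility \<gamma> (p k) + ((1 - Q) * b k) * iso_utility \<gamma> (1 - p k)
      < (Q * a k) * iso_utility \<gamma> (bet \<gamma> Q k) + ((1 - Q) * b k) * iso_utility \<gamma> (1 - bet \<gamma> Q k)"
    using assms a_k0 b_k0 k0_le unfolding bet_def
    by (intro bexI[of _ k0] portion_best_response_less) auto
qed simp

lemma bet_k0_strict_mono:
  assumes "0 < \<gamma>" "0 < P" "P < Q" "Q < 1"
  shows "bet \<gamma> P k0 < bet \<gamma> Q k0"
  using assms a_k0 b_k0 by (simp add: bet_def portion_posterior_strict_mono)

lemma payoff_constant_at_slope_root:
  assumes "slope \<gamma> P = 0" "\<gamma> < 1"
  shows "payoff \<gamma> Q (bet \<gamma> P) = payoff \<gamma> P (bet \<gamma> P)"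
proof -
  have "(\<Sum>k\<le>N. a k * iso_utility \<gamma> (bet \<gamma> P k)) = (\<Sum>k\<le>N. b k * iso_utility \<gamma> (1 - bet \<gamma> P k))"
    using assms
    by (simp add: slope_def iso_utility_def right_diff_distrib sum_subtractf sum_a sum_b
        flip: sum_divide_distrib)
  then show ?thesis by (simp add: payoff_def algebra_simps)
qed

text \<open>
  A saddle-point argument.  The bets at a root \<open>P\<close> equalize the payoff over all priors; against
  \<open>Q \<noteq> P\<close> they differ from the optimal bets at \<open>k0\<close>, so the optimal payoff at \<open>Q\<close> exceeds the
  common value.
\<close>
lemma is_arg_min_unique_at_slope_root:
  assumes "slope \<gamma> P = 0" "0 < P" "P < 1" "0 < \<gamma>" "\<gamma> < 1"
  shows "(THE Q. is_arg_min (\<lambda>Q. payoff \<gamma> Q (bet \<gamma> Q)) (\<lambda>Q. Q \<in> {0<..<1}) Q) = P"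
proof -
  have less: "payoff \<gamma> P (bet \<gamma> P) < payoff \<gamma> Q (bet \<gamma> Q)" if "Q \<in> {0<..<1}" "Q \<noteq> P" for Q
  proof -
    have "bet \<gamma> P k0 \<noteq> bet \<gamma> Q k0"
      using that assms bet_k0_strict_mono[of \<gamma> P Q] bet_k0_strict_mono[of \<gamma> Q P]
      by (cases "P < Q") auto
    then have "payoff \<gamma> Q (bet \<gamma> P) < payoff \<gamma> Q (bet \<gamma> Q)"
      using that assms by (intro payoff_less_best_response bet_bounds) auto
    then show ?thesis using payoff_constant_at_slope_root[OF assms(1,5), of Q] by linarith
  qed
  show ?thesis
    unfolding is_arg_min_def
  proof (rule the_equality)
    have "\<not> payoff \<gamma> Q (bet \<gamma> Q) < payoff \<gamma> P (bet \<gamma> P)" if "Q \<in> {0<..<1}" for Q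
      using less[OF that] by (cases "Q = P") (simp_all add: not_less less_imp_le)
    then show "P \<in> {0<..<1} \<and>
        (\<nexists>Q. Q \<in> {0<..<1} \<and> payoff \<gamma> Q (bet \<gamma> Q) < payoff \<gamma> P (bet \<gamma> P))"
      using assms by simp
  next
    fix Q
    assume Q: "Q \<in> {0<..<1} \<and>
        (\<nexists>R. R \<in> {0<..<1} \<and> payoff \<gamma> R (bet \<gamma> R) < payoff \<gamma> Q (bet \<gamma> Q))"
    show "Q = P"
    proof (rule ccontr)
      assume "Q \<noteq> P"
      then have "payoff \<gamma> P (bet \<gamma> P) < payoff \<gamma> Q (bet \<gamma> Q)" using less Q by blast
      moreover have "P \<in> {0<..<1}" using assms by simp
      ultimately show False using Q by blast
    qed
  qed
qed

lemma continuous_on_slope: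
  assumes "0 < \<gamma>" "\<gamma> < 1"
  shows "continuous_on {0<..<1} (slope \<gamma>)"
proof -
  have bet: "continuous_on {0<..<1} (\<lambda>P. bet \<gamma> P k)" for k
    unfolding bet_def by (rule continuous_on_portion_posterior) (simp_all add: a_nonneg b_nonneg assms)
  have "continuous_on {0<..<1} (\<lambda>P. bet \<gamma> P k powr (1 - \<gamma>))"
    "continuous_on {0<..<1} (\<lambda>P. (1 - bet \<gamma> P k) powr (1 - \<gamma>))" for k
    using assms
    by (simp_all add: bet_bounds continuous_on_powr'[OF bet continuous_on_const]
        continuous_on_powr'[OF continuous_on_diff[OF continuous_on_const bet] continuous_on_const])
  then show ?thesis
    unfolding slope_def by (intro continuous_on_sum continuous_on_diff continuous_on_mult_left)
qed

lemma slope_term_tendsto: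
  assumes "((\<lambda>\<gamma>. p \<gamma>) \<longlongrightarrow> l) (at_right 0)"
    and "\<And>\<gamma>. 0 \<le> p \<gamma>" "\<And>\<gamma>. p \<gamma> \<le> (1::real)"
  shows "((\<lambda>\<gamma>. u * p \<gamma> powr (1 - \<gamma>) - v * (1 - p \<gamma>) powr (1 - \<gamma>)) \<longlongrightarrow> u * l - v * (1 - l)) (at_right 0)"
proof -
  have l: "0 \<le> l" "l \<le> 1"
    using tendsto_lowerbound[OF assms(1)] tendsto_upperbound[OF assms(1)] assms by auto
  have g: "((\<lambda>\<gamma>. 1 - \<gamma>) \<longlongrightarrow> 1 - 0) (at_right (0::real))" by (intro tendsto_intros)
  have "((\<lambda>\<gamma>. p \<gamma> powr (1 - \<gamma>)) \<longlongrightarrow> l powr (1 - 0)) (at_right 0)"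
    using assms by (intro tendsto_powr' g) auto
  moreover have "((\<lambda>\<gamma>. (1 - p \<gamma>) powr (1 - \<gamma>)) \<longlongrightarrow> (1 - l) powr (1 - 0)) (at_right 0)"
    using assms by (intro tendsto_powr'[OF tendsto_diff[OF tendsto_const assms(1)] g]) auto
  ultimately have "((\<lambda>\<gamma>. u * p \<gamma> powr (1 - \<gamma>) - v * (1 - p \<gamma>) powr (1 - \<gamma>))
      \<longlongrightarrow> u * l powr (1 - 0) - v * (1 - l) powr (1 - 0)) (at_right 0)"
    by (intro tendsto_diff tendsto_mult_left)
  then show ?thesis using l by simp
qed

lemma bet_tendsto_1:
  assumes "(P \<longlongrightarrow> L) (at_right 0)" "0 < L" "L < 1" "(1 - L) * b k < L * a k"
  shows "((\<lambda>\<gamma>. bet \<gamma> (P \<gamma>) k) \<longlongrightarrow> 1) (at_right 0)"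
proof -
  have "\<forall>\<^sub>F \<gamma> in at_right 0. P \<gamma> < 1" using assms by (intro order_tendstoD)
  then have "\<forall>\<^sub>F \<gamma> in at_right 0. 0 \<le> (1 - P \<gamma>) * b k"
    by eventually_elim (simp add: b_nonneg)
  then show ?thesis unfolding bet_def
    by (intro portion_tendsto_1[OF _ _ _ assms(4)] tendsto_intros assms)
qed

lemma bet_tendsto_0:
  assumes "(P \<longlongrightarrow> L) (at_right 0)" "0 < L" "L < 1" "L * a k < (1 - L) * b k"
  shows "((\<lambda>\<gamma>. bet \<gamma> (P \<gamma>) k) \<longlongrightarrow> 0) (at_right 0)"
proof -
  have "\<forall>\<^sub>F \<gamma> in at_right 0. 0 < P \<gamma>" using assms by (intro order_tendstoD)
  then have "\<forall>\<^sub>F \<gamma> in at_right 0. 0 \<le> P \<gamma> * a k"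
    by eventually_elim (simp add: a_nonneg)
  then show ?thesis unfolding bet_def
    by (intro portion_tendsto_0[OF _ _ _ assms(4)] tendsto_intros assms)
qed

lemma slope_term_tendsto_low:
  assumes "(P \<longlongrightarrow> L) (at_right 0)" "0 < L" "L < 1"
    and "0 < a k + b k \<Longrightarrow> (1 - L) * b k < L * a k"
  shows "((\<lambda>\<gamma>. a k * bet \<gamma> (P \<gamma>) k powr (1 - \<gamma>) - b k * (1 - bet \<gamma> (P \<gamma>) k) powr (1 - \<gamma>))
     \<longlongrightarrow> a k) (at_right 0)"
proof (cases "0 < a k + b k")
  case False
  then have "a k = 0" "b k = 0" using a_nonneg[of k] b_nonneg[of k] by linarith+
  then show ?thesis by simp
next
  case True
  from slope_term_tendsto[OF bet_tendsto_1[OF assms(1-3) assms(4)[OF True]] bet_bounds, of "a k" "b k"]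
  show ?thesis by simp
qed

lemma slope_term_tendsto_high:
  assumes "(P \<longlongrightarrow> L) (at_right 0)" "0 < L" "L < 1"
    and "0 < a k + b k \<Longrightarrow> L * a k < (1 - L) * b k"
  shows "((\<lambda>\<gamma>. a k * bet \<gamma> (P \<gamma>) k powr (1 - \<gamma>) - b k * (1 - bet \<gamma> (P \<gamma>) k) powr (1 - \<gamma>))
     \<longlongrightarrow> - b k) (at_right 0)"
proof (cases "0 < a k + b k")
  case False
  then have "a k = 0" "b k = 0" using a_nonneg[of k] b_nonneg[of k] by linarith+
  then show ?thesis by simp
next
  case True
  from slope_term_tendsto[OF bet_tendsto_0[OF assms(1-3) assms(4)[OF True]] bet_bounds, of "a k" "b k"]
  show ?thesis by simp
qed

text \<open>The slope produced by betting everything on A below \<open>n\<close> and everything on B from \<open>n\<close> on.\<close>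
lemma sum_threshold:
  assumes "n \<le> Suc N"
  shows "(\<Sum>k\<le>N. if k < n then a k else - b k) = (\<Sum>k<n. a k + b k) - 1"
proof -
  have "(\<Sum>k\<le>N. if k < n then a k else - b k) + (\<Sum>k\<le>N. b k)
      = (\<Sum>k\<le>N. if k < n then a k + b k else 0)"
    unfolding sum.distrib[symmetric] by (intro sum.cong) auto
  also have "\<dots> = (\<Sum>k\<in>{k\<in>{..N}. k < n}. a k + b k)"
    by (rule sum.inter_filter[symmetric]) simp
  also have "{k\<in>{..N}. k < n} = {..<n}" using assms by auto
  finally show ?thesis using sum_b by simp
qed

text \<open>
  At a prior without ties every bet on a possible observation becomes extreme, and impossible
  observations have weight 0 in the slope.
\<close>
lemma slope_tendsto:
  assumes "0 < P" "P < 1" "n \<le> Suc N"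
    and low: "\<And>k. k < n \<Longrightarrow> 0 < a k + b k \<Longrightarrow> (1 - P) * b k < P * a k"
    and high: "\<And>k. n \<le> k \<Longrightarrow> k \<le> N \<Longrightarrow> 0 < a k + b k \<Longrightarrow> P * a k < (1 - P) * b k"
  shows "((\<lambda>\<gamma>. slope \<gamma> P) \<longlongrightarrow> (\<Sum>k<n. a k + b k) - 1) (at_right 0)"
  unfolding slope_def sum_threshold[OF assms(3), symmetric]
proof (rule tendsto_sum)
  fix k assume k: "k \<in> {..N}"
  show "((\<lambda>\<gamma>. a k * bet \<gamma> P k powr (1 - \<gamma>) - b k * (1 - bet \<gamma> P k) powr (1 - \<gamma>))
    \<longlongrightarrow> (if k < n then a k else - b k)) (at_right 0)"
  proof (cases "k < n")
    case True
    show ?thesis using slope_term_tendsto_low[OF tendsto_const assms(1,2) low[OF True]] True by simp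
  next
    case False
    then show ?thesis using slope_term_tendsto_high[OF tendsto_const assms(1,2) high[of k]] k by simp
  qed
qed

text \<open>
  Priors that order the two scenarios as \<open>P0\<close> does at every index except the tie \<open>k0\<close>; finitely
  many strict inequalities, so all priors near \<open>P0\<close> qualify.
\<close>
definition separates :: "real \<Rightarrow> bool" where
  "separates P \<longleftrightarrow> 0 < P \<and> P < 1 \<and>
     (\<forall>k<k0. 0 < a k + b k \<longrightarrow> (1 - P) * b k < P * a k) \<and>
     (\<forall>k\<in>{k0<..N}. 0 < a k + b k \<longrightarrow> P * a k < (1 - P) * b k)"

lemma eventually_separates: "\<forall>\<^sub>F P in nhds P0. separates P"
proof -
  have lim: "((\<lambda>P. P * a k - (1 - P) * b k) \<longlongrightarrow> P0 * a k - (1 - P0) * b k) (nhds P0)" for k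
    by (intro tendsto_intros filterlim_ident)
  have "\<forall>\<^sub>F P in nhds P0. 0 < P" "\<forall>\<^sub>F P in nhds P0. P < 1"
    using P0_bounds order_tendstoD[OF filterlim_ident] by blast+
  moreover have "\<forall>\<^sub>F P in nhds P0. \<forall>k\<in>{..<k0}. 0 < a k + b k \<longrightarrow> (1 - P) * b k < P * a k"
  proof (rule eventually_ball_finite)
    show "\<forall>k\<in>{..<k0}. \<forall>\<^sub>F P in nhds P0. 0 < a k + b k \<longrightarrow> (1 - P) * b k < P * a k"
    proof
      fix k assume "k \<in> {..<k0}"
      then show "\<forall>\<^sub>F P in nhds P0. 0 < a k + b k \<longrightarrow> (1 - P) * b k < P * a k"
        using order_tendstoD(1)[OF lim[of k], of 0] P0_below[of k] by (cases "0 < a k + b k") auto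
    qed
  qed simp
  moreover have "\<forall>\<^sub>F P in nhds P0. \<forall>k\<in>{k0<..N}. 0 < a k + b k \<longrightarrow> P * a k < (1 - P) * b k"
  proof (rule eventually_ball_finite)
    show "\<forall>k\<in>{k0<..N}. \<forall>\<^sub>F P in nhds P0. 0 < a k + b k \<longrightarrow> P * a k < (1 - P) * b k"
    proof
      fix k assume "k \<in> {k0<..N}"
      then show "\<forall>\<^sub>F P in nhds P0. 0 < a k + b k \<longrightarrow> P * a k < (1 - P) * b k"
        using order_tendstoD(2)[OF lim[of k], of 0] P0_above[of k] by (cases "0 < a k + b k") auto
    qed
  qed simp
  ultimately show ?thesis
    unfolding separates_def by eventually_elim auto
qed

lemma eventually_slope_neg:
  assumes "separates P" "P < P0"
  shows "\<forall>\<^sub>F \<gamma> in at_right 0. slope \<gamma> P < 0"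
proof (rule order_tendstoD(2))
  have "P * a k0 < P0 * a k0" "(1 - P0) * b k0 < (1 - P) * b k0"
    using assms a_k0 b_k0 by auto
  then have "P * a k0 < (1 - P) * b k0" using P0_tie by linarith
  then show "((\<lambda>\<gamma>. slope \<gamma> P) \<longlongrightarrow> (\<Sum>k<k0. a k + b k) - 1) (at_right 0)"
    using assms k0_le by (intro slope_tendsto) (auto simp: separates_def le_less)
  show "(\<Sum>k<k0. a k + b k) - 1 < 0" using sum_below_k0 by simp
qed

lemma eventually_slope_pos:
  assumes "separates P" "P0 < P"
  shows "\<forall>\<^sub>F \<gamma> in at_right 0. 0 < slope \<gamma> P"
proof (rule order_tendstoD(1))
  have "P0 * a k0 < P * a k0" "(1 - P) * b k0 < (1 - P0) * b k0"
    using assms a_k0 b_k0 by auto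
  then have "(1 - P) * b k0 < P * a k0" using P0_tie by linarith
  then show "((\<lambda>\<gamma>. slope \<gamma> P) \<longlongrightarrow> (\<Sum>k<Suc k0. a k + b k) - 1) (at_right 0)"
    using assms k0_le by (intro slope_tendsto) (auto simp: separates_def less_Suc_eq)
  show "0 < (\<Sum>k<Suc k0. a k + b k) - 1"
    using sum_upto_k0 unfolding lessThan_Suc_atMost by simp
qed

lemma slope_root:
  assumes "0 < \<gamma>" "\<gamma> < 1" "0 < P" "P < Q" "Q < 1" "slope \<gamma> P < 0" "0 < slope \<gamma> Q"
  shows "\<exists>R. P < R \<and> R < Q \<and> slope \<gamma> R = 0"
proof -
  have "continuous_on {P..Q} (slope \<gamma>)"
    by (rule continuous_on_subset[OF continuous_on_slope]) (use assms in auto)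
  then obtain R where "P \<le> R" "R \<le> Q" "slope \<gamma> R = 0"
    using IVT'[of "slope \<gamma>" P 0 Q] assms by auto
  then show ?thesis using assms by (metis less_irrefl order_le_less)
qed

definition minimizer :: "real \<Rightarrow> real" where
  "minimizer \<gamma> = (THE Q. is_arg_min (\<lambda>Q. payoff \<gamma> Q (bet \<gamma> Q)) (\<lambda>Q. Q \<in> {0<..<1}) Q)"

text \<open>
  The slope changes sign between two separating priors on either side of \<open>P0\<close>, both as close to
  \<open>P0\<close> as desired; its root in between is the minimizer.
\<close>
lemma eventually_minimizer_between:
  assumes "l < P0" "P0 < u"
  shows "\<forall>\<^sub>F \<gamma> in at_right 0. l < minimizer \<gamma> \<and> minimizer \<gamma> < u \<and> slope \<gamma> (minimizer \<gamma>) = 0"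
proof -
  have sep: "\<forall>\<^sub>F P in at P0 within S. separates P" for S
    using eventually_separates unfolding eventually_at_filter by (rule eventually_mono) simp
  have "\<forall>\<^sub>F P in at_left P0. separates P \<and> l < P \<and> P < P0"
    using sep eventually_at_left_real[OF assms(1)] by eventually_elim auto
  then obtain P where P: "separates P" "l < P" "P < P0"
    using eventually_happens'[OF trivial_limit_at_left_real] by blast
  have "\<forall>\<^sub>F Q in at_right P0. separates Q \<and> P0 < Q \<and> Q < u"
    using sep eventually_at_right_real[OF assms(2)] by eventually_elim auto
  then obtain Q where Q: "separates Q" "P0 < Q" "Q < u"
    using eventually_happens'[OF trivial_limit_at_right_real] by blast
  have "\<forall>\<^sub>F \<gamma> in at_right 0. \<gamma> \<in> {0<..<1::real}" by (rule eventually_at_right_real) simp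
  with eventually_slope_neg[OF P(1,3)] eventually_slope_pos[OF Q(1,2)] show ?thesis
  proof eventually_elim
    case (elim \<gamma>)
    have PQ: "0 < P" "Q < 1" using P Q by (auto simp: separates_def)
    obtain R where R: "P < R" "R < Q" "slope \<gamma> R = 0"
      using slope_root[of \<gamma> P Q] elim P Q PQ by auto
    have "minimizer \<gamma> = R"
      unfolding minimizer_def using R elim PQ by (intro is_arg_min_unique_at_slope_root) auto
    then show ?case using R P Q by simp
  qed
qed

lemma minimizer_tendsto: "(minimizer \<longlongrightarrow> P0) (at_right 0)"
proof (rule order_tendstoI)
  show "\<forall>\<^sub>F \<gamma> in at_right 0. l < minimizer \<gamma>" if "l < P0" for l
    by (rule eventually_mono[OF eventually_minimizer_between[OF that, of "P0 + 1"]]) auto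
  show "\<forall>\<^sub>F \<gamma> in at_right 0. minimizer \<gamma> < u" if "P0 < u" for u
    by (rule eventually_mono[OF eventually_minimizer_between[OF _ that, of "P0 - 1"]]) auto
qed

lemma eventually_slope_minimizer: "\<forall>\<^sub>F \<gamma> in at_right 0. slope \<gamma> (minimizer \<gamma>) = 0"
  by (rule eventually_mono[OF eventually_minimizer_between[of "P0 - 1" "P0 + 1"]]) auto

lemma bet_below_tendsto:
  assumes "k < k0" "0 < a k + b k"
  shows "((\<lambda>\<gamma>. bet \<gamma> (minimizer \<gamma>) k) \<longlongrightarrow> 1) (at_right 0)"
  using P0_bounds P0_below[OF assms] by (intro bet_tendsto_1[OF minimizer_tendsto])

lemma bet_above_tendsto:
  assumes "k0 < k" "0 < a k + b k"
  shows "((\<lambda>\<gamma>. bet \<gamma> (minimizer \<gamma>) k) \<longlongrightarrow> 0) (at_right 0)"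
  using P0_bounds P0_above[OF assms] by (intro bet_tendsto_0[OF minimizer_tendsto])

text \<open>
  Nothing about the tied index \<open>k0\<close> can be read off from the limit of the priors.  Its bet is instead
  determined by the vanishing of the slope, in which all other terms have known limits.
\<close>
lemma bet_k0_tendsto: "((\<lambda>\<gamma>. bet \<gamma> (minimizer \<gamma>) k0) \<longlongrightarrow> \<nu>) (at_right 0)"
proof -
  define p where "p \<gamma> = bet \<gamma> (minimizer \<gamma>) k0" for \<gamma>
  define t where "t \<gamma> k = a k * bet \<gamma> (minimizer \<gamma>) k powr (1 - \<gamma>)
     - b k * (1 - bet \<gamma> (minimizer \<gamma>) k) powr (1 - \<gamma>)" for \<gamma> k
  define f where "f k = (if k < k0 then a k else - b k)" for k
  define R where "R = (\<Sum>k\<in>{..N} - {k0}. f k)"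
  have p: "0 \<le> p \<gamma>" "p \<gamma> \<le> 1" for \<gamma> by (simp_all add: p_def bet_bounds)
  have "((\<lambda>\<gamma>. \<Sum>k\<in>{..N} - {k0}. t \<gamma> k) \<longlongrightarrow> R) (at_right 0)"
    unfolding R_def
  proof (rule tendsto_sum)
    fix k assume "k \<in> {..N} - {k0}"
    then consider "k < k0" | "k0 < k" by fastforce
    then show "((\<lambda>\<gamma>. t \<gamma> k) \<longlongrightarrow> f k) (at_right 0)"
    proof cases
      case 1
      then show ?thesis unfolding t_def f_def
        using slope_term_tendsto_low[OF minimizer_tendsto P0_bounds P0_below] by simp
    next
      case 2
      then show ?thesis unfolding t_def f_def
        using slope_term_tendsto_high[OF minimizer_tendsto P0_bounds P0_above] by simp
    qed
  qed
  moreover have "\<forall>\<^sub>F \<gamma> in at_right 0. (\<Sum>k\<in>{..N} - {k0}. t \<gamma> k) = - t \<gamma> k0"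
    using eventually_slope_minimizer
  proof eventually_elim
    case (elim \<gamma>)
    then have "(\<Sum>k\<le>N. t \<gamma> k) = 0" by (simp add: slope_def t_def)
    then show ?case using sum.remove[of "{..N}" k0 "t \<gamma>"] k0_le by simp
  qed
  ultimately have t: "((\<lambda>\<gamma>. - t \<gamma> k0) \<longlongrightarrow> R) (at_right 0)"
    by (rule Lim_transform_eventually)
  have e1: "((\<lambda>\<gamma>. p \<gamma> powr (1 - \<gamma>) - p \<gamma>) \<longlongrightarrow> 0) (at_right 0)"
    using p by (rule powr_minus_self_tendsto_0)
  have e2: "((\<lambda>\<gamma>. (1 - p \<gamma>) powr (1 - \<gamma>) - (1 - p \<gamma>)) \<longlongrightarrow> 0) (at_right 0)"
    using p by (intro powr_minus_self_tendsto_0) auto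
  \<comment> \<open>The equation defining \<open>t \<gamma> k0\<close>, solved for \<open>p \<gamma>\<close> with two error terms that vanish in the limit.\<close>
  have "((\<lambda>\<gamma>. (b k0 - (- t \<gamma> k0) - a k0 * (p \<gamma> powr (1 - \<gamma>) - p \<gamma>)
        + b k0 * ((1 - p \<gamma>) powr (1 - \<gamma>) - (1 - p \<gamma>))) / (a k0 + b k0))
      \<longlongrightarrow> (b k0 - R - a k0 * 0 + b k0 * 0) / (a k0 + b k0)) (at_right 0)"
    using a_k0 b_k0 by (intro tendsto_intros t e1 e2) auto
  moreover have "(b k0 - (- t \<gamma> k0) - a k0 * (p \<gamma> powr (1 - \<gamma>) - p \<gamma>)
        + b k0 * ((1 - p \<gamma>) powr (1 - \<gamma>) - (1 - p \<gamma>))) / (a k0 + b k0) = p \<gamma>" for \<gamma>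
  proof -
    have "b k0 - (- t \<gamma> k0) - a k0 * (p \<gamma> powr (1 - \<gamma>) - p \<gamma>)
        + b k0 * ((1 - p \<gamma>) powr (1 - \<gamma>) - (1 - p \<gamma>)) = p \<gamma> * (a k0 + b k0)"
      by (simp add: t_def p_def algebra_simps)
    then show ?thesis using a_k0 b_k0 by simp
  qed
  moreover have "(b k0 - R - a k0 * 0 + b k0 * 0) / (a k0 + b k0) = \<nu>"
  proof -
    have "(\<Sum>k<k0. a k + b k) - 1 = R - b k0"
      using sum_threshold[of k0] sum.remove[of "{..N}" k0 f] k0_le by (simp add: R_def f_def)
    moreover have "(\<Sum>k=k0..N. b k) + (\<Sum>k<k0. b k) = 1"
    proof -
      have "{..N} = {k0..N} \<union> {..<k0}" using k0_le by auto
      then show ?thesis using sum_b by (simp add: sum.union_disjoint disjoint_iff)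
    qed
    ultimately show ?thesis by (simp add: \<nu>_def sum.distrib)
  qed
  ultimately show ?thesis by (simp add: p_def)
qed

end

section \<open>The likelihood ratio of the hypergeometric distribution\<close>

text \<open>
  Choosing \<open>j\<close> elements and then \<open>i\<close> of these turns \<open>n choose j\<close> into a multiple of
  \<open>(n choose i) * ((n - i) choose (j - i))\<close>, and only the last factor distinguishes \<open>n\<close> from \<open>m\<close>.
\<close>
lemma binomial_strictly_totally_positive:
  fixes m n i j :: nat
  assumes "m < n" "i < j" "i \<le> m" "j \<le> n"
  shows "(m choose j) * (n choose i) < (m choose i) * (n choose j)"
proof (cases "j \<le> m")
  case False
  then show ?thesis using assms by (simp add: binomial_eq_0)
next
  case True
  have "(m - i) choose (j - i) < (n - i) choose (j - i)"
  proof -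
    obtain d where d: "j - i = Suc d" using assms by (metis Suc_diff_Suc)
    have "(m - i) choose Suc d < Suc (m - i) choose Suc d"
      using d True assms by simp
    also have "\<dots> \<le> (n - i) choose Suc d"
      using assms by (intro binomial_right_mono) auto
    finally show ?thesis using d by simp
  qed
  then have "(m choose i) * (n choose i) * ((m - i) choose (j - i))
      < (m choose i) * (n choose i) * ((n - i) choose (j - i))"
    using assms by (intro mult_strict_left_mono) auto
  moreover have "(m choose j) * (j choose i) = (m choose i) * ((m - i) choose (j - i))"
    using True assms by (intro choose_mult) auto
  moreover have "(n choose j) * (j choose i) = (n choose i) * ((n - i) choose (j - i))"
    using assms by (intro choose_mult) auto
  ultimately have "((m choose j) * (j choose i)) * (n choose i) < (m choose i) * ((n choose j) * (j choose i))"
    by (simp only: ac_simps)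
  then have "(j choose i) * ((m choose j) * (n choose i)) < (j choose i) * ((m choose i) * (n choose j))"
    by (simp only: ac_simps)
  then show ?thesis by (rule mult_less_cancel1[THEN iffD1, THEN conjunct2])
qed

lemma ones_prob_nonneg: "0 \<le> ones_prob N K M k"
  by (simp add: ones_prob_def)

lemma ones_prob_pos_iff:
  assumes "N \<le> M"
  shows "0 < ones_prob N K M k \<longleftrightarrow> k \<le> N \<and> k \<le> K \<and> N - k \<le> M - K"
  using assms by (auto simp: ones_prob_def zero_less_divide_iff zero_less_mult_iff)

lemma sum_ones_prob:
  assumes "N \<le> M" "K \<le> M"
  shows "(\<Sum>k\<le>N. ones_prob N K M k) = 1"
proof -
  have "(\<Sum>k\<le>N. ones_prob N K M k)
      = real (\<Sum>k\<le>N. (K choose k) * ((M - K) choose (N - k))) / real (M choose N)"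
    by (simp add: ones_prob_def sum_divide_distrib)
  also have "\<dots> = 1"
    using assms by (simp add: vandermonde del: of_nat_sum)
  finally show ?thesis .
qed

text \<open>
  Total positivity is used twice: for the ones with \<open>KA < KB\<close>, and for the zeros, where both the
  population sizes and the sample counts are in reversed order.
\<close>
lemma ones_prob_strict_likelihood_ratio:
  assumes "N \<le> M" "KA < KB" "KB \<le> M" "i < j"
    and "0 < ones_prob N KA M i" "0 < ones_prob N KB M j"
  shows "ones_prob N KA M j * ones_prob N KB M i < ones_prob N KA M i * ones_prob N KB M j"
proof -
  have b: "i \<le> N" "i \<le> KA" "N - i \<le> M - KA" "j \<le> N" "j \<le> KB" "N - j \<le> M - KB"
    using assms by (auto simp: ones_prob_pos_iff)
  have 1: "(KA choose j) * (KB choose i) < (KA choose i) * (KB choose j)"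
    using assms b by (intro binomial_strictly_totally_positive) auto
  have 2: "((M - KB) choose (N - i)) * ((M - KA) choose (N - j))
      < ((M - KB) choose (N - j)) * ((M - KA) choose (N - i))"
    using assms b by (intro binomial_strictly_totally_positive) auto
  have "((KA choose j) * (KB choose i)) * (((M - KB) choose (N - i)) * ((M - KA) choose (N - j)))
      < ((KA choose i) * (KB choose j)) * (((M - KB) choose (N - j)) * ((M - KA) choose (N - i)))"
    using 1 2 by (intro mult_strict_mono'[OF 1 2]) simp_all
  then have "real (((KA choose j) * (KB choose i)) * (((M - KB) choose (N - i)) * ((M - KA) choose (N - j))))
      < real (((KA choose i) * (KB choose j)) * (((M - KB) choose (N - j)) * ((M - KA) choose (N - i))))"
    by (simp only: of_nat_less_iff)
  moreover have "0 < real (M choose N)" using assms by simp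
  ultimately show ?thesis
    using b by (simp add: ones_prob_def field_simps)
qed

text \<open>
  The supports are intervals that move to the right with the number of ones.  This lets the strict
  inequality above be used when positivity is known only for the smaller product.
\<close>
lemma ones_prob_pos_cross:
  assumes "N \<le> M" "KA < KB" "KB \<le> M" "i < j"
    and "0 < ones_prob N KB M i" "0 < ones_prob N KA M j"
  shows "0 < ones_prob N KA M i" "0 < ones_prob N KB M j"
  using assms by (auto simp: ones_prob_pos_iff)

section \<open>The Fisher threshold\<close>
lemma fisher_k_bounds:
  assumes "N \<le> M" "KA \<le> M" "KB \<le> M"
  shows "fisher_k N KA KB M \<le> N"
    and "1 < (\<Sum>k\<le>fisher_k N KA KB M. ones_prob N KA M k + ones_prob N KB M k)"
    and "(\<Sum>k<fisher_k N KA KB M. ones_prob N KA M k + ones_prob N KB M k) \<le> 1"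
proof -
  define S where "S n = (\<Sum>k\<le>n. ones_prob N KA M k + ones_prob N KB M k)" for n
  have ks: "fisher_k N KA KB M = (LEAST n. 1 < S n)" by (simp add: fisher_k_def S_def)
  have N: "1 < S N" using assms by (simp add: S_def sum.distrib sum_ones_prob)
  show "fisher_k N KA KB M \<le> N" unfolding ks by (rule Least_le) (rule N)
  show "1 < (\<Sum>k\<le>fisher_k N KA KB M. ones_prob N KA M k + ones_prob N KB M k)"
    unfolding ks using LeastI[of "\<lambda>n. 1 < S n", OF N] by (simp add: S_def)
  show "(\<Sum>k<fisher_k N KA KB M. ones_prob N KA M k + ones_prob N KB M k) \<le> 1"
  proof (cases "fisher_k N KA KB M")
    case (Suc n)
    then have "\<not> 1 < S n" unfolding ks by (intro not_less_Least) simp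
    then show ?thesis by (simp add: Suc S_def lessThan_Suc_atMost)
  qed simp
qed

text \<open>
  The numerator of \<open>\<nu>\<close> equals \<open>1 - (\<Sum>k<k0. a k + b k)\<close>, so \<open>\<nu> \<noteq> 0\<close> excludes that the total mass
  is exactly 1 below \<open>k0\<close>.  It also forces the supports to meet at \<open>k0\<close>: if A were impossible
  there, all of the mass of A would lie below \<open>k0\<close>; if B were impossible there, the mass up to \<open>k0\<close>
  would be that of A alone, which is at most 1.
\<close>
lemma betting_game_ones_prob:
  assumes "N \<le> M" "KA < KB" "KB \<le> M" "fisher_nu N KA KB M \<noteq> 0"
  shows "betting_game N (ones_prob N KA M) (ones_prob N KB M) (fisher_k N KA KB M)"
proof -
  define a where "a = ones_prob N KA M"
  define b where "b = ones_prob N KB M"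
  define k0 where "k0 = fisher_k N KA KB M"
  have nonneg: "0 \<le> a k" "0 \<le> b k" for k by (simp_all add: a_def b_def ones_prob_nonneg)
  have sums: "(\<Sum>k\<le>N. a k) = 1" "(\<Sum>k\<le>N. b k) = 1"
    using assms by (simp_all add: a_def b_def sum_ones_prob)
  have cross: "0 < a i" "0 < b j" if "i < j" "0 < b i" "0 < a j" for i j
    using ones_prob_pos_cross[OF assms(1-3) that(1)] that by (simp_all add: a_def b_def)
  have ratio: "a j * b i < a i * b j" if "i < j" "0 < a i" "0 < b j" for i j
    using ones_prob_strict_likelihood_ratio[OF assms(1-3) that(1)] that by (simp add: a_def b_def)
  have k0: "k0 \<le> N" "1 < (\<Sum>k\<le>k0. a k + b k)" "(\<Sum>k<k0. a k + b k) \<le> 1"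
    using fisher_k_bounds[of N M KA KB] assms by (auto simp: k0_def a_def b_def)
  have N: "{..N} = {..<k0} \<union> {k0..N}" using k0 by auto
  have split: "(\<Sum>k\<le>N. f k) = (\<Sum>k<k0. f k) + (\<Sum>k=k0..N. f k)" for f :: "nat \<Rightarrow> real"
    unfolding N by (rule sum.union_disjoint) auto
  have less: "(\<Sum>k<k0. a k + b k) < 1"
  proof -
    have "(\<Sum>k=k0..N. b k) - (\<Sum>k<k0. a k) \<noteq> 0"
      using assms(4) by (auto simp: fisher_nu_def Let_def k0_def a_def b_def)
    then have "(\<Sum>k<k0. a k + b k) \<noteq> 1"
      using split[of b] sums by (simp add: sum.distrib)
    then show ?thesis using k0 by simp
  qed
  have "{..k0} = insert k0 {..<k0}" by auto
  then have "0 < a k0 + b k0" using k0(2) less by simp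
  have a0: "0 < a k0"
  proof (rule ccontr)
    assume "\<not> 0 < a k0"
    with \<open>0 < a k0 + b k0\<close> nonneg[of k0] have z: "a k0 = 0" "0 < b k0" by linarith+
    have "a k = 0" if "k \<in> {k0..N}" for k
      using cross(1)[of k0 k] z that nonneg(1)[of k] by (cases "k = k0") force+
    then have "(\<Sum>k<k0. a k) = 1" using split[of a] sums by simp
    moreover have "0 \<le> (\<Sum>k<k0. b k)" using nonneg by (simp add: sum_nonneg)
    ultimately show False using less by (simp add: sum.distrib)
  qed
  have b0: "0 < b k0"
  proof (rule ccontr)
    assume "\<not> 0 < b k0"
    with nonneg[of k0] have z: "b k0 = 0" by linarith
    have "b k = 0" if "k \<in> {..k0}" for k
      using cross(2)[of k k0] z a0 that nonneg(2)[of k] by (cases "k = k0") force+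
    then have "(\<Sum>k\<le>k0. a k + b k) = (\<Sum>k\<le>k0. a k)" by simp
    also have "\<dots> \<le> (\<Sum>k\<le>N. a k)" using k0 nonneg by (intro sum_mono2) auto
    finally show False using k0 sums by simp
  qed
  have "betting_game N a b k0"
  proof
    fix k
    show "0 \<le> a k" "0 \<le> b k" by (fact nonneg)+
    assume pos: "0 < a k + b k"
    show "a k0 * b k < a k * b k0" if "k < k0"
      using ratio[OF that] cross[OF that] pos a0 b0 nonneg[of k] by (cases "0 < a k") force+
    show "a k * b k0 < a k0 * b k" if "k0 < k"
      using ratio[OF that] cross[OF that] pos a0 b0 nonneg[of k] by (cases "0 < b k") force+
  qed (use sums k0 a0 b0 less in auto)
  then show ?thesis by (simp add: a_def b_def k0_def)
qed

theorem theorem5p2: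
  fixes N KA KB M :: nat
  assumes "N \<le> M" and "KA < KB" and "KB \<le> M"
    and "fisher_nu N KA KB M \<noteq> 0"
  shows "((\<lambda>\<gamma>. stat_bet N KA KB M \<gamma> (fisher_k N KA KB M)) \<longlongrightarrow> fisher_nu N KA KB M) (at_right 0)
    \<and> ((\<lambda>\<gamma>. stat_P N KA KB M \<gamma>) \<longlongrightarrow> fisher_P N KA KB M) (at_right 0)
    \<and> (\<forall>k. ones_prob N KA M k + ones_prob N KB M k > 0 \<longrightarrow>
          ((\<lambda>\<gamma>. stat_bet N KA KB M \<gamma> k) \<longlongrightarrow> fisher_guess N KA KB M k) (at_right 0))"
proof -
  interpret betting_game N "ones_prob N KA M" "ones_prob N KB M" "fisher_k N KA KB M"
    using assms by (rule betting_game_ones_prob)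
  have nu: "\<nu> = fisher_nu N KA KB M" by (simp add: \<nu>_def fisher_nu_def Let_def)
  have P: "P0 = fisher_P N KA KB M" by (simp add: P0_def fisher_P_def Let_def)
  have bet: "bet \<gamma> Q k = stat_portion N KA KB M \<gamma> Q k" for \<gamma> Q k
    by (simp add: bet_def stat_portion_def portion_def)
  have min: "minimizer = stat_P N KA KB M"
    by (simp add: fun_eq_iff minimizer_def stat_P_def payoff_def bet stat_utility_def[abs_def])
  have k0: "((\<lambda>\<gamma>. stat_bet N KA KB M \<gamma> (fisher_k N KA KB M)) \<longlongrightarrow> fisher_nu N KA KB M) (at_right 0)"
    using bet_k0_tendsto by (simp add: stat_bet_def bet min nu)
  moreover have "((\<lambda>\<gamma>. stat_bet N KA KB M \<gamma> k) \<longlongrightarrow> fisher_guess N KA KB M k) (at_right 0)"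
    if "0 < ones_prob N KA M k + ones_prob N KB M k" for k
  proof (cases k "fisher_k N KA KB M" rule: linorder_cases)
    case less
    then show ?thesis using bet_below_tendsto[OF _ that] by (simp add: stat_bet_def bet min fisher_guess_def)
  next
    case equal
    then show ?thesis using k0 by (simp add: fisher_guess_def)
  next
    case greater
    then show ?thesis using bet_above_tendsto[OF _ that] by (simp add: stat_bet_def bet min fisher_guess_def)
  qed
  ultimately show ?thesis
    using minimizer_tendsto by (simp add: min P)
qed

end
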